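(* Consider a field $\mathbb{F}$ such that $\operatorname{char}\mathbb{F}\neq 3$ and $\mathbb{F}$ contains a primitive cube root of unity. Let nonzero matrices $x,y\in\mathcal{N}_3$ be such that $d([x],[y])=k$ in $\Gamma_O^{\mathcal{N}_3}(M_3(\mathbb{F}))$, $0\leq k\leq 5$. Then either there exists a unique path of length $k$ between $[x]$ and $[y]$, or there are exactly two such paths. The second possibility is achieved precisely in the following cases: (1) $d([x],[y])=3$, and $x^2=y^2=0$; (2) $d([x],[y])=4$, and $x^2=0$ or $y^2=0$; (3) $d([x],[y])=5$.
   Context: $\mathcal{N}_3$ is the set of nilpotent matrices in the algebra $M_3(\mathbb{F})$ of $3\times3$ matrices over $\mathbb{F}$. For $x\neq0$ write $[x]=\mathbb{F}x$. $\Gamma_O^{\mathcal{N}_3}(M_3(\mathbb{F}))$ is the undirected graph whose vertices are the lines $[x]$ with $x\in\mathcal{N}_3\setminus\{0\}$, two distinct vertices $[a],[b]$ being adjacent if and only if $ab=ba=0$; it is the induced subgraph, on these vertices, of the orthogonality graph of $M_3(\mathbb{F})$. Here $d$ is the distance and paths are taken in this graph. *)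

theory Defs
  imports
    "Jordan_Normal_Form.Matrix"
    "Graph_Theory.Graph_Theory"
begin

definition primitive_cube_root :: "'a::field \<Rightarrow> bool" where
  "primitive_cube_root w \<longleftrightarrow> w ^ 3 = 1 \<and> (\<forall>j. 0 < j \<and> j < 3 \<longrightarrow> w ^ j \<noteq> 1)"

definition nilpotent3 :: "'a::field mat set" where
  "nilpotent3 = {x \<in> carrier_mat 3 3. \<exists>n. x ^\<^sub>m n = 0\<^sub>m 3 3}"

definition line :: "'a::field mat \<Rightarrow> 'a mat set" where
  "line x = {c \<cdot>\<^sub>m x | c. True}"

text \<open>
  Undirected graphs are symmetric loop-free digraphs. Arcs are pairs of vertices, so an
  \<^const>\<open>pre_digraph.apath\<close> from \<open>u\<close> to \<open>v\<close> (a list of consecutive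
  arcs that repeats no vertex) amounts to a path of the undirected graph, its length being the number of edges.
\<close>

definition orth_graph :: "'a::field mat set \<Rightarrow> 'a mat set pair_pre_digraph" where
  "orth_graph S = \<lparr>
     pverts = {line a | a. a \<in> S - {0\<^sub>m 3 3}},
     parcs = {(line a, line b) | a b. a \<in> S - {0\<^sub>m 3 3} \<and> b \<in> S - {0\<^sub>m 3 3} \<and>
       line a \<noteq> line b \<and> a * b = 0\<^sub>m 3 3 \<and> b * a = 0\<^sub>m 3 3}\<rparr>"

lemma pair_bidirected_orth_graph: "pair_bidirected_digraph (orth_graph S)"
  by unfold_locales
    (auto simp: orth_graph_def symmetric_def arcs_ends_conv intro!: symI)

text \<open>The library's weighted distance, every edge having length 1; it is \<open>\<infinity>\<close> between
  vertices in different components.\<close>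

definition graph_dist :: "'v pair_pre_digraph \<Rightarrow> 'v \<Rightarrow> 'v \<Rightarrow> ereal" where
  "graph_dist G u v = wf_digraph.\<mu> (with_proj G) (\<lambda>_. 1) u v"

definition paths_of_length ::
    "'v pair_pre_digraph \<Rightarrow> nat \<Rightarrow> 'v \<Rightarrow> 'v \<Rightarrow> ('v \<times> 'v) awalk set" where
  "paths_of_length G k u v = {p. pre_digraph.apath (with_proj G) u p v \<and> length p = k}"

end

theory Submission
  imports Defs "HOL-Library.Product_Plus"
begin

text \<open>
  A nonzero square-zero \<open>3 \<times> 3\<close> matrix is an outer product \<open>u f\<^sup>T\<close> with \<open>f \<cdot> u = 0\<close>, that is, a flag
  of the projective plane: the point \<open>[u]\<close> on the line \<open>ker f\<close>. Two such matrices annihilate each other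
  on both sides iff their flags share the point or the line. A nilpotent \<open>x\<close> with \<open>x\<^sup>2 \<noteq> 0\<close> has rank 2,
  so the matrices annihilating it on both sides are the multiples of \<open>x\<^sup>2\<close>: it is a pendant vertex hanging
  off the flag of \<open>x\<^sup>2\<close>. In the graph of flags the diameter is 3, geodesics of length at most 2 are
  unique, and two flags in general position are joined by exactly two geodesics, one through the
  join of the points and one through the meet of the lines.
\<close>

section \<open>Geodesics\<close>

context pair_sym_digraph
begin

text \<open>Vertices may repeat here, which gives a plain recursion on the first arc; at the
  geodesic length no repetition can occur, and these are the paths to be counted.\<close>

definition walks :: "nat \<Rightarrow> 'a \<Rightarrow> 'a \<Rightarrow> ('a \<times> 'a) awalk set" where
  "walks k u v = {p. awalk u p v \<and> length p = k}"

definition geodesic_length :: "nat \<Rightarrow> 'a \<Rightarrow> 'a \<Rightarrow> bool" where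
  "geodesic_length k u v \<longleftrightarrow> walks k u v \<noteq> {} \<and> (\<forall>j<k. walks j u v = {})"

text \<open>With unit weights the distance is an infimum of natural numbers, hence attained: some
  walk costs less than \<open>k + 1\<close>, and none costs less than \<open>k\<close>.\<close>

lemma graph_dist_eq_imp_geodesic_length:
  assumes "graph_dist G u v = ereal (real k)"
  shows "geodesic_length k u v"
proof -
  have cost: "awalk_cost (\<lambda>_. 1) p = real (length p)" for p :: "('a \<times> 'a) awalk"
    by (induction p) auto
  have INF: "(INF p\<in>{p. awalk u p v}. ereal (real (length p))) = ereal (real k)"
    using assms by (simp add: graph_dist_def \<mu>_def cost)
  have ge: "k \<le> length p" if "awalk u p v" for p
  proof -
    have "ereal (real k) \<le> ereal (real (length p))"
      unfolding INF[symmetric] using that by (intro INF_lower) simp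
    then show ?thesis by simp
  qed
  have "(INF p\<in>{p. awalk u p v}. ereal (real (length p))) < ereal (real k + 1)"
    unfolding INF by simp
  then obtain p where p: "awalk u p v" "length p < k + 1"
    by (force simp: INF_less_iff)
  with ge[OF p(1)] have "p \<in> walks k u v" by (simp add: walks_def)
  moreover have "walks j u v = {}" if "j < k" for j
    using that by (auto simp: walks_def dest: ge)
  ultimately show ?thesis by (auto simp: geodesic_length_def)
qed

text \<open>Cutting a closed piece out of a walk that repeats a vertex leaves a strictly shorter
  walk, so a walk of minimal length is a path.\<close>

lemma paths_of_length_eq_walks:
  assumes "geodesic_length k u v"
  shows "paths_of_length G k u v = walks k u v"
proof -
  have "apath u p v" if p: "awalk u p v" "length p = k" for p
  proof (rule ccontr)
    assume "\<not> apath u p v"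
    then have "\<not> distinct (awalk_verts u p)"
      using p by (simp add: apath_def)
    then obtain q r s w where "p = q @ r @ s" "0 < length r" "awalk u q w" "awalk w s v"
      using awalk_not_distinct_decomp[OF p(1)] by blast
    then have "awalk u (q @ s) v" by (blast intro: awalk_appendI)
    then have "q @ s \<in> walks (length (q @ s)) u v" by (simp add: walks_def)
    moreover have "length (q @ s) < k"
      using p(2) \<open>p = q @ r @ s\<close> \<open>0 < length r\<close> by auto
    ultimately
    show False
      using assms by (auto simp: geodesic_length_def)
  qed
  then show ?thesis
    by (auto simp: paths_of_length_def walks_def apath_def)
qed

lemma walks_0: "walks 0 u v = (if u = v \<and> u \<in> pverts G then {[]} else {})"
  by (auto simp: walks_def awalk_Nil_iff)

lemma walks_Suc: "walks (Suc k) u v = (\<Union>w\<in>{w. (u, w) \<in> parcs G}. (#) (u, w) ` walks k w v)"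
  by (force simp: walks_def length_Suc_conv awalk_Cons_iff image_iff)

text \<open>Reversal turns a pendant last vertex into a pendant first vertex.\<close>

lemma walks_rev: "walks k v u = rev_path ` walks k u v"
proof -
  have len: "length (rev_path p) = length p" for p :: "('a \<times> 'a) awalk"
    by (induction p) auto
  show ?thesis
    by (auto simp: walks_def len image_iff intro!: exI[of _ "rev_path _"] dest: awalk_rev_path')
qed

lemma card_walks_rev: "card (walks k v u) = card (walks k u v)"
  unfolding walks_rev[of k v u] by (intro card_image inj_onI) (simp add: rev_path_eq)

lemma geodesic_length_sym: "geodesic_length k v u \<longleftrightarrow> geodesic_length k u v"
  unfolding geodesic_length_def walks_rev[of _ v u] by simp

lemma walks_1: "walks (Suc 0) u v = (if (u, v) \<in> parcs G then {[(u, v)]} else {})"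
  by (auto simp: walks_Suc walks_0 split: if_splits dest: in_arcsD2)

lemma walks_2:
  "walks 2 u v = (\<lambda>w. [(u, w), (w, v)]) ` {w. (u, w) \<in> parcs G \<and> (w, v) \<in> parcs G}"
  by (auto simp: numeral_2_eq_2 walks_Suc[of "Suc 0"] walks_1 split: if_splits)

lemma walks_3:
  "walks 3 u v = (\<lambda>(w, z). [(u, w), (w, z), (z, v)]) `
     {(w, z). (u, w) \<in> parcs G \<and> (w, z) \<in> parcs G \<and> (z, v) \<in> parcs G}"
  by (force simp: numeral_3_eq_3 walks_Suc[of "Suc (Suc 0)"] walks_2[unfolded numeral_2_eq_2])

end

text \<open>
  The flags of a projective plane together with pendant vertices; \<open>pt\<close> and \<open>ln\<close> name the point and
  the line of a flag. The plane is presented through its flags only, without an incidence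
  relation, so two points have a common line when flags through them have the same \<open>ln\<close>.
\<close>

locale pendant_flag_graph = pair_sym_digraph G for G :: "'v pair_pre_digraph" +
  fixes flags :: "'v set" and pt :: "'v \<Rightarrow> 'p" and ln :: "'v \<Rightarrow> 'l"
  assumes flags_subset: "flags \<subseteq> pverts G"
    and arc_iff: "A \<in> flags \<Longrightarrow> B \<in> flags \<Longrightarrow>
      (A, B) \<in> parcs G \<longleftrightarrow> A \<noteq> B \<and> (pt A = pt B \<or> ln A = ln B)"
    and flag_eqI: "A \<in> flags \<Longrightarrow> B \<in> flags \<Longrightarrow> pt A = pt B \<Longrightarrow> ln A = ln B \<Longrightarrow> A = B"
    and join: "A \<in> flags \<Longrightarrow> B \<in> flags \<Longrightarrow> pt A \<noteq> pt B \<Longrightarrow>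
      \<exists>C\<in>flags. \<exists>D\<in>flags. pt C = pt A \<and> pt D = pt B \<and> ln C = ln D"
    and meet: "A \<in> flags \<Longrightarrow> B \<in> flags \<Longrightarrow> ln A \<noteq> ln B \<Longrightarrow>
      \<exists>C\<in>flags. \<exists>D\<in>flags. ln C = ln A \<and> ln D = ln B \<and> pt C = pt D"
    and join_unique: "\<lbrakk>A \<in> flags; A' \<in> flags; B \<in> flags; B' \<in> flags; pt A = pt A'; pt B = pt B';
      ln A = ln B; ln A' = ln B'\<rbrakk> \<Longrightarrow> pt A = pt B \<or> ln A = ln A'"
    and pendant: "A \<in> pverts G \<Longrightarrow> A \<notin> flags \<Longrightarrow>
      \<exists>C\<in>flags. \<forall>B. (A, B) \<in> parcs G \<longleftrightarrow> B = C"
begin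

section \<open>Counting geodesics in a flag graph with pendant vertices\<close>

lemma arc_sym: "(A, B) \<in> parcs G \<longleftrightarrow> (B, A) \<in> parcs G"
  using arcs_symmetric by blast

text \<open>The cases are equal flags, flags sharing exactly one of point and line, and flags
  sharing neither. In the last case a common neighbour is unique, and without one the join and the
  meet give the only two routes.\<close>

lemma flag_geodesics:
  assumes "A \<in> flags" "B \<in> flags" and geo: "geodesic_length k A B"
  shows "k \<le> 3" "card (walks k A B) = (if k = 3 then 2 else 1)"
proof -
  have A: "A \<in> pverts G" and B: "B \<in> pverts G"
    using assms flags_subset by auto
  \<comment> \<open>A pendant vertex has a single neighbour, so an interior vertex with distinct
    neighbours on its two sides is a flag.\<close>
  have inner: "w \<in> flags" if "(A, w) \<in> parcs G" "(w, z) \<in> parcs G" "z \<noteq> A" for w z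
    using that pendant[of w] arc_sym[of A w] in_arcsD1 by metis
  have inner': "z \<in> flags" if "(z, B) \<in> parcs G" "(w, z) \<in> parcs G" "w \<noteq> B" for w z
    using that pendant[of z] arc_sym[of w z] in_arcsD1 by metis
  have far: "k \<le> j" if "walks j A B \<noteq> {}" for j
    using geo that by (auto simp: geodesic_length_def not_less[symmetric])
  consider "A = B" | "A \<noteq> B" "pt A = pt B \<or> ln A = ln B" | "pt A \<noteq> pt B" "ln A \<noteq> ln B"
    by blast
  then have "k \<le> 3 \<and> card (walks k A B) = (if k = 3 then 2 else 1)"
  proof cases
    case 1
    then have "k = 0" using far[of 0] A by (simp add: walks_0)
    then show ?thesis using 1 A by (simp add: walks_0)
  next
    case 2
    then have arc: "(A, B) \<in> parcs G" using arc_iff assms by blast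
    then have "k \<le> 1" using far[of 1] by (simp add: walks_1)
    moreover have "k \<noteq> 0" using geo 2 by (auto simp: geodesic_length_def walks_0 split: if_splits)
    ultimately have "k = Suc 0" by simp
    then show ?thesis using arc by (simp add: walks_1)
  next
    case 3
    \<comment> \<open>Candidates for the two routes: \<open>A, C, D, B\<close> runs along the join
      of the points, \<open>A, C', D', B\<close> through the meet of the lines.\<close>
    obtain C D where CD: "C \<in> flags" "D \<in> flags" "pt C = pt A" "pt D = pt B" "ln C = ln D"
      using join[OF assms(1,2) 3(1)] by blast
    obtain C' D' where CD': "C' \<in> flags" "D' \<in> flags" "ln C' = ln A" "ln D' = ln B" "pt C' = pt D'"
      using meet[OF assms(1,2) 3(2)] by blast
    have noarc: "(A, B) \<notin> parcs G" using arc_iff assms 3 by blast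
    have k: "k \<ge> 2"
    proof (rule ccontr)
      assume "\<not> k \<ge> 2"
      then consider "k = 0" | "k = Suc 0" by linarith
      then show False
        using geo 3 noarc by cases (auto simp: geodesic_length_def walks_0 walks_1 split: if_splits)
    qed
    show ?thesis
    proof (cases "\<exists>w. (A, w) \<in> parcs G \<and> (w, B) \<in> parcs G")
      case True
      then obtain w where w: "(A, w) \<in> parcs G" "(w, B) \<in> parcs G" by blast
      have "k = 2" using k far[of 2] w by (force simp: walks_2)
      \<comment> \<open>A common neighbour takes its point from one end and its line from the other.
        Two of opposite kinds would put both points on both lines, against
        \<open>join_unique\<close>; two of the same kind agree by \<open>flag_eqI\<close>.\<close>
      have "w' = w" if w': "(A, w') \<in> parcs G" "(w', B) \<in> parcs G" for w'
      proof -
        have f: "w \<in> flags" "w' \<in> flags"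
          using inner[OF w] inner[OF w'] 3 by auto
        have types: "pt v = pt A \<and> ln v = ln B \<or> ln v = ln A \<and> pt v = pt B"
          if "v \<in> flags" "(A, v) \<in> parcs G" "(v, B) \<in> parcs G" for v
          using that 3 assms(1,2) by (auto simp: arc_iff)
        have "\<not> (pt v = pt A \<and> ln v = ln B \<and> ln v' = ln A \<and> pt v' = pt B)"
          if "v \<in> flags" "v' \<in> flags" for v v'
          using join_unique[of A v v' B] that assms(1,2) 3 by auto
        then have "pt w' = pt w \<and> ln w' = ln w"
          using types[OF f(1) w] types[OF f(2) w'] f by metis
        then show ?thesis using f flag_eqI by blast
      qed
      with w have "{w. (A, w) \<in> parcs G \<and> (w, B) \<in> parcs G} = {w}" by blast
      then show ?thesis using \<open>k = 2\<close> by (simp add: walks_2)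
    next
      case False
      \<comment> \<open>Any coincidence would give \<open>A\<close> and \<open>B\<close> a common
        point, a common line or a common neighbour.\<close>
      have neq: "A \<noteq> C" "C \<noteq> D" "D \<noteq> B" "A \<noteq> C'" "C' \<noteq> D'" "D' \<noteq> B"
      proof -
        have no: "\<not> ((A, v) \<in> parcs G \<and> (v, B) \<in> parcs G)" for v using False by blast
        show "A \<noteq> C" using no[of D] CD 3 assms(1,2) by (auto simp: arc_iff)
        show "C \<noteq> D" using no[of C] CD 3 assms(1,2) by (auto simp: arc_iff)
        show "D \<noteq> B" using no[of C] CD 3 assms(1,2) by (auto simp: arc_iff)
        show "A \<noteq> C'" using no[of D'] CD' 3 assms(1,2) by (auto simp: arc_iff)
        show "C' \<noteq> D'" using no[of C'] CD' 3 assms(1,2) by (auto simp: arc_iff)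
        show "D' \<noteq> B" using no[of C'] CD' 3 assms(1,2) by (auto simp: arc_iff)
      qed
      have arcs: "(A, C) \<in> parcs G" "(C, D) \<in> parcs G" "(D, B) \<in> parcs G"
        "(A, C') \<in> parcs G" "(C', D') \<in> parcs G" "(D', B) \<in> parcs G"
        using neq CD CD' assms(1,2) by (auto simp: arc_iff)
      have "walks 3 A B \<noteq> {}" using arcs(1-3) by (auto simp: walks_3)
      moreover have "k \<noteq> 2" using False geo by (auto simp: geodesic_length_def walks_2)
      ultimately have k3: "k = 3" using k far[of 3] by simp
      \<comment> \<open>Two consecutive arcs keeping the same point or line could be replaced by
        one, giving a walk of length 2. So the arcs alternate: point, line, point yields
        \<open>C, D\<close>, and line, point, line yields \<open>C', D'\<close>.\<close>
      have "(w, z) = (C, D) \<or> (w, z) = (C', D')"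
        if wz: "(A, w) \<in> parcs G" "(w, z) \<in> parcs G" "(z, B) \<in> parcs G" for w z
      proof -
        have "z \<noteq> A" "w \<noteq> B" using wz noarc by auto
        then have f: "w \<in> flags" "z \<in> flags" using inner inner' wz by blast+
        have "(A, z) \<notin> parcs G" "(w, B) \<notin> parcs G" using wz False by blast+
        then have "pt A \<noteq> pt z" "ln A \<noteq> ln z" "pt w \<noteq> pt B" "ln w \<noteq> ln B"
          using f assms(1,2) \<open>z \<noteq> A\<close> \<open>w \<noteq> B\<close> by (auto simp: arc_iff)
        moreover have "pt A = pt w \<or> ln A = ln w" "pt w = pt z \<or> ln w = ln z" "pt z = pt B \<or> ln z = ln B"
          using wz f assms(1,2) by (auto simp: arc_iff)
        ultimately consider "pt w = pt A" "ln w = ln z" "pt z = pt B" | "ln w = ln A" "pt w = pt z" "ln z = ln B"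
          by auto
        then show ?thesis
        proof cases
          case 1
          then have "ln w = ln C" using join_unique[of w C z D] f CD 3 by metis
          then show ?thesis using 1 f CD flag_eqI by (metis (no_types))
        next
          case 2
          \<comment> \<open>\<open>join_unique\<close> read dually: two distinct lines meet in only
            one point.\<close>
          then have "pt w = pt C'" using join_unique[of w z C' D'] f CD' 3 by metis
          then show ?thesis using 2 f CD' flag_eqI by (metis (no_types))
        qed
      qed
      then have "{(w, z). (A, w) \<in> parcs G \<and> (w, z) \<in> parcs G \<and> (z, B) \<in> parcs G} = {(C, D), (C', D')}"
        using arcs by blast
      \<comment> \<open>A common value would have the point and the line of \<open>A\<close>, hence
        be \<open>A\<close>; so the two routes differ.\<close>
      moreover have "C \<noteq> C'" using flag_eqI[of A C] neq(1) CD CD' assms(1) by auto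
      ultimately show ?thesis using k3 by (simp add: walks_3)
    qed
  qed
  then show "k \<le> 3" "card (walks k A B) = (if k = 3 then 2 else 1)" by auto
qed

text \<open>The first step from a pendant vertex is forced, so removing it lowers the length by one
  and keeps the number of geodesics.\<close>

lemma pendant_geodesics:
  assumes A: "A \<in> pverts G" "A \<notin> flags" and "A \<noteq> B" and geo: "geodesic_length k A B"
  obtains j C where "C \<in> flags" "k = Suc j" "geodesic_length j C B"
    "card (walks k A B) = card (walks j C B)"
proof -
  obtain C where C: "C \<in> flags" "\<And>B. (A, B) \<in> parcs G \<longleftrightarrow> B = C"
    using pendant[OF A] by blast
  then have walks: "walks (Suc j) A B = (#) (A, C) ` walks j C B" for j
    by (simp add: walks_Suc)
  have "k \<noteq> 0" using geo \<open>A \<noteq> B\<close> by (auto simp: geodesic_length_def walks_0)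
  then obtain j where j: "k = Suc j" using not0_implies_Suc by blast
  moreover have "geodesic_length j C B"
    using geo unfolding j geodesic_length_def by (metis Suc_mono image_is_empty walks)
  moreover have "card (walks k A B) = card (walks j C B)"
    unfolding j walks by (intro card_image) auto
  ultimately show ?thesis using that C(1) by blast
qed

text \<open>Stripping pendant ends reduces to two flags. Each such end adds one to the length, so
  the double geodesics at flag distance 3 appear at length 3, 4 or 5 with no, one or two pendant
  ends.\<close>

lemma card_geodesics:
  assumes A: "A \<in> pverts G" and B: "B \<in> pverts G" and geo: "geodesic_length k A B"
  shows "card (walks k A B) = 1 \<or> card (walks k A B) = 2"
    and "card (walks k A B) = 2 \<longleftrightarrow>
      k = 3 \<and> A \<in> flags \<and> B \<in> flags \<or> k = 4 \<and> (A \<in> flags \<or> B \<in> flags) \<or> k = 5"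
proof -
  \<comment> \<open>The case of one pendant end, for arbitrary vertices, so that it also applies
    after reversal and after stripping one of two pendant ends.\<close>
  have one: "k \<le> 4 \<and> card (walks k A B) = (if k = 4 then 2 else 1)"
    if "A \<in> pverts G" "A \<notin> flags" "B \<in> flags" "geodesic_length k A B" for A B k
  proof -
    have "A \<noteq> B" using that by blast
    from pendant_geodesics[OF that(1,2) this that(4)] obtain j C where
      "C \<in> flags" "k = Suc j" "geodesic_length j C B" "card (walks k A B) = card (walks j C B)" .
    with flag_geodesics[OF _ that(3)] show ?thesis by auto
  qed
  have "(card (walks k A B) = 1 \<or> card (walks k A B) = 2) \<and> (card (walks k A B) = 2 \<longleftrightarrow>
      k = 3 \<and> A \<in> flags \<and> B \<in> flags \<or> k = 4 \<and> (A \<in> flags \<or> B \<in> flags) \<or> k = 5)"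
  proof (cases "A \<in> flags"; cases "B \<in> flags")
    assume f: "A \<in> flags" "B \<in> flags"
    show ?thesis using flag_geodesics[OF f geo] f by auto
  next
    assume f: "A \<notin> flags" "B \<in> flags"
    show ?thesis using one[OF A f geo] f by auto
  next
    assume f: "A \<in> flags" "B \<notin> flags"
    have "geodesic_length k B A" using geo by (simp add: geodesic_length_sym[of k B A])
    from one[OF B f(2,1) this] show ?thesis using f by (auto simp: card_walks_rev[of k B A])
  next
    assume f: "A \<notin> flags" "B \<notin> flags"
    show ?thesis
    proof (cases "A = B")
      \<comment> \<open>The only geodesic is the empty walk, which has no first step to
        strip.\<close>
      case True
      have "k = 0"
        using geo A True by (metis geodesic_length_def insert_not_empty not_gr_zero walks_0)
      then show ?thesis using True A f by (simp add: walks_0)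
    next
      case False
      obtain j C where j: "C \<in> flags" "k = Suc j" "geodesic_length j C B"
        "card (walks k A B) = card (walks j C B)"
        using pendant_geodesics[OF A f(1) False geo] .
      have "geodesic_length j B C"
        using j(3) by (simp add: geodesic_length_sym[of j B])
      from one[OF B f(2) j(1) this] show ?thesis
        using j f by (auto simp: card_walks_rev[of j B])
    qed
  qed
  then show "card (walks k A B) = 1 \<or> card (walks k A B) = 2"
    "card (walks k A B) = 2 \<longleftrightarrow>
      k = 3 \<and> A \<in> flags \<and> B \<in> flags \<or> k = 4 \<and> (A \<in> flags \<or> B \<in> flags) \<or> k = 5"
    by blast+
qed

end

section \<open>Rank-one matrices and cross products\<close>

lemma less_3_iff: "(i::nat) < 3 \<longleftrightarrow> i = 0 \<or> i = 1 \<or> i = 2"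
  by auto

lemma all_less_3: "(\<forall>i<3. P i) \<longleftrightarrow> P 0 \<and> P (1::nat) \<and> P 2"
  by (auto simp: less_3_iff)

section \<open>Dot and cross products of triples\<close>

type_synonym 'a triple = "'a \<times> 'a \<times> 'a"

text \<open>Links the components of a triple to matrix indices; every index from 2 on reads the last
  component.\<close>

fun entry :: "'a triple \<Rightarrow> nat \<Rightarrow> 'a" where
  "entry (a, b, c) i = (if i = 0 then a else if i = 1 then b else c)"

fun dot :: "'a::field triple \<Rightarrow> 'a triple \<Rightarrow> 'a" where
  "dot (a, b, c) (x, y, z) = a * x + b * y + c * z"

fun cross :: "'a::field triple \<Rightarrow> 'a triple \<Rightarrow> 'a triple" where
  "cross (a, b, c) (x, y, z) = (b * z - c * y, c * x - a * z, a * y - b * x)"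

fun scale :: "'a::field \<Rightarrow> 'a triple \<Rightarrow> 'a triple" where
  "scale k (a, b, c) = (k * a, k * b, k * c)"

lemma dot_commute: "dot u v = dot v u"
  by (cases u; cases v) (simp add: mult.commute)

lemma cross_anticommute: "cross u v = - cross v u"
  by (cases u; cases v) simp

lemma cross_eq_0_commute: "cross u v = 0 \<longleftrightarrow> cross v u = 0"
  by (subst cross_anticommute) simp

lemma cross_self [simp]: "cross u u = 0"
  by (cases u) (simp add: zero_prod_def)

lemma dot_cross [simp]: "dot u (cross u v) = 0" "dot v (cross u v) = 0"
  by (cases u; cases v; simp add: algebra_simps)+

lemma dot_cross' [simp]: "dot (cross u v) u = 0" "dot (cross u v) v = 0"
  by (simp_all add: dot_commute[of "cross u v"])

text \<open>A vanishing cross product serves throughout as equality of projective points. The factor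
  is the ratio of the coordinates at a place where \<open>u\<close> is nonzero.\<close>

lemma parallel_iff_scale:
  assumes "u \<noteq> 0"
  shows "cross u v = 0 \<longleftrightarrow> (\<exists>k. v = scale k u)"
proof
  obtain a b c where u: "u = (a, b, c)" by (metis prod_cases3)
  obtain x y z where v: "v = (x, y, z)" by (metis prod_cases3)
  assume "cross u v = 0"
  then have *: "b * z = c * y" "c * x = a * z" "a * y = b * x"
    by (auto simp: u v zero_prod_def)
  consider "a \<noteq> 0" | "b \<noteq> 0" | "c \<noteq> 0" using assms by (auto simp: u zero_prod_def)
  then show "\<exists>k. v = scale k u"
  proof cases
    case 1 then show ?thesis using * by (intro exI[of _ "x / a"]) (simp add: u v field_simps)
  next
    case 2 then show ?thesis using * by (intro exI[of _ "y / b"]) (simp add: u v field_simps)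
  next
    case 3 then show ?thesis using * by (intro exI[of _ "z / c"]) (simp add: u v field_simps)
  qed
next
  assume "\<exists>k. v = scale k u"
  then show "cross u v = 0" by (cases u) (auto simp: zero_prod_def)
qed

text \<open>Parallelism as vanishing of all 2 x 2 minors, a form that is symmetric in rows and
  columns.\<close>

lemma parallel_iff_entries:
  "cross u v = 0 \<longleftrightarrow> (\<forall>i<3. \<forall>j<3. entry u i * entry v j = entry u j * entry v i)"
  by (cases u; cases v) (auto simp: all_less_3 zero_prod_def)

lemma parallel_trans:
  assumes "n \<noteq> 0" "cross n u = 0" "cross n v = 0"
  shows "cross u v = 0"
proof -
  obtain k l where "u = scale k n" "v = scale l n"
    using assms parallel_iff_scale by metis
  then show ?thesis by (cases n) (simp add: zero_prod_def)
qed

text \<open>The expansion of the vector triple product; it makes any \<open>f\<close> orthogonal to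
  \<open>u\<close> and \<open>v\<close> parallel to \<open>cross u v\<close>.\<close>

lemma cross_cross: "cross f (cross u v) = scale (dot f v) u - scale (dot f u) v"
  by (cases f; cases u; cases v) (simp add: algebra_simps)

lemma cross_cross_eq_0:
  assumes "dot f u = 0" "dot f v = 0"
  shows "cross f (cross u v) = 0"
  using assms unfolding cross_cross by (cases u; cases v) (simp add: zero_prod_def)

text \<open>Both \<open>f\<close> and \<open>g\<close> are parallel to \<open>cross u v\<close>,
  hence to each other when this is nonzero. Projectively: two distinct points lie on only one
  line.\<close>

lemma orthogonal_dichotomy:
  assumes "dot f u = 0" "dot f v = 0" "dot g u = 0" "dot g v = 0"
  shows "cross u v = 0 \<or> cross f g = 0"
proof (rule disjCI)
  assume "cross f g \<noteq> 0"
  moreover have "cross (cross u v) f = 0" "cross (cross u v) g = 0"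
    using assms cross_cross_eq_0 by (simp_all add: cross_eq_0_commute[of "cross u v"])
  ultimately show "cross u v = 0"
    using parallel_trans by blast
qed

lemma dot_parallel:
  assumes "u \<noteq> 0" "cross u v = 0" "dot f u = 0"
  shows "dot f v = 0"
proof -
  obtain k where "v = scale k u" using assms parallel_iff_scale by metis
  moreover have "dot f (scale k u) = k * dot f u"
    by (cases f; cases u) (simp add: algebra_simps)
  ultimately show ?thesis using assms(3) by simp
qed

section \<open>Outer products and the rows and columns of a matrix\<close>

definition outer :: "'a::field triple \<Rightarrow> 'a triple \<Rightarrow> 'a mat" where
  "outer u f = mat 3 3 (\<lambda>(i, j). entry u i * entry f j)"

definition row3 :: "'a mat \<Rightarrow> nat \<Rightarrow> 'a triple" where
  "row3 A i = (A $$ (i, 0), A $$ (i, 1), A $$ (i, 2))"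

definition col3 :: "'a mat \<Rightarrow> nat \<Rightarrow> 'a triple" where
  "col3 A j = (A $$ (0, j), A $$ (1, j), A $$ (2, j))"

lemma mat3_eq_iff:
  assumes "A \<in> carrier_mat 3 3" "B \<in> carrier_mat 3 3"
  shows "A = B \<longleftrightarrow> (\<forall>i<3. \<forall>j<3. A $$ (i, j) = B $$ (i, j))"
  using assms by (auto intro!: eq_matI)

lemma outer_carrier [simp]: "outer u f \<in> carrier_mat 3 3"
  by (simp add: outer_def)

lemma outer_dim [simp]: "dim_row (outer u f) = 3" "dim_col (outer u f) = 3"
  by (simp_all add: outer_def)

lemma outer_index [simp]: "i < 3 \<Longrightarrow> j < 3 \<Longrightarrow> outer u f $$ (i, j) = entry u i * entry f j"
  by (simp add: outer_def)

lemma mult_index_3: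
  assumes "A \<in> carrier_mat 3 3" "B \<in> carrier_mat 3 3" "i < 3" "j < 3"
  shows "(A * B) $$ (i, j) = dot (row3 A i) (col3 B j)"
  using assms by (simp add: scalar_prod_def row3_def col3_def numeral_3_eq_3 numeral_2_eq_2)

lemma mult_eq_0_iff_3:
  assumes "A \<in> carrier_mat 3 3" "B \<in> carrier_mat 3 3"
  shows "A * B = 0\<^sub>m 3 3 \<longleftrightarrow> (\<forall>i<3. \<forall>j<3. dot (row3 A i) (col3 B j) = 0)"
proof -
  have "A * B \<in> carrier_mat 3 3" using assms by simp
  then show ?thesis
    using assms by (subst mat3_eq_iff) (auto simp: mult_index_3 simp del: index_mult_mat)
qed

lemma row3_outer: "i < 3 \<Longrightarrow> row3 (outer u f) i = scale (entry u i) f"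
  by (cases f) (simp add: row3_def)

lemma col3_outer: "j < 3 \<Longrightarrow> col3 (outer u f) j = scale (entry f j) u"
  by (cases u) (simp add: col3_def mult.commute)

lemma triple_eq_0_iff: "u = 0 \<longleftrightarrow> (\<forall>i<3. entry u i = 0)"
  by (cases u) (simp add: zero_prod_def all_less_3)

lemma outer_eq_0_iff: "outer u f = 0\<^sub>m 3 3 \<longleftrightarrow> u = 0 \<or> f = 0"
  by (subst mat3_eq_iff) (auto simp: triple_eq_0_iff)

lemma outer_mult_eq_0_iff:
  "outer u f * outer v g = 0\<^sub>m 3 3 \<longleftrightarrow> u = 0 \<or> g = 0 \<or> dot f v = 0"
proof -
  have "dot (scale a f) (scale b v) = a * b * dot f v" for a b
    by (cases f; cases v) (simp add: algebra_simps)
  then show ?thesis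
    by (auto simp: mult_eq_0_iff_3 row3_outer col3_outer triple_eq_0_iff)
qed

lemma outer_scale: "outer (scale k u) (scale l f) = (k * l) \<cdot>\<^sub>m outer u f"
  by (cases u; cases f) (auto simp: outer_def intro!: eq_matI)

text \<open>Comparing entries along one row and one column through a nonzero entry recovers each
  factor up to a scalar.\<close>

lemma outer_eq_smult_iff:
  assumes "u \<noteq> 0" "f \<noteq> 0" "v \<noteq> 0" "g \<noteq> 0"
  shows "(\<exists>k. outer v g = k \<cdot>\<^sub>m outer u f) \<longleftrightarrow> cross u v = 0 \<and> cross f g = 0"
proof
  assume "\<exists>k. outer v g = k \<cdot>\<^sub>m outer u f"
  then obtain k where k: "outer v g = k \<cdot>\<^sub>m outer u f" by blast
  have e: "entry v i * entry g j = k * (entry u i * entry f j)" if "i < 3" "j < 3" for i j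
    using arg_cong[OF k, of "\<lambda>M. M $$ (i, j)"] that by (simp add: outer_def)
  obtain i j where ij: "i < 3" "entry v i \<noteq> 0" "j < 3" "entry g j \<noteq> 0"
    using assms by (auto simp: triple_eq_0_iff)
  have "entry g l = k * entry u i / entry v i * entry f l" if "l < 3" for l
    using e[OF ij(1) that] ij by (simp add: field_simps)
  then have "g = scale (k * entry u i / entry v i) f"
    by (cases g; cases f) (force simp: less_3_iff)
  moreover have "entry v l = k * entry f j / entry g j * entry u l" if "l < 3" for l
    using e[OF that ij(3)] ij by (simp add: field_simps)
  then have "v = scale (k * entry f j / entry g j) u"
    by (cases v; cases u) (force simp: less_3_iff)
  ultimately show "cross u v = 0 \<and> cross f g = 0"
    using assms parallel_iff_scale by blast
next
  assume "cross u v = 0 \<and> cross f g = 0"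
  then show "\<exists>k. outer v g = k \<cdot>\<^sub>m outer u f"
    using assms parallel_iff_scale[of u v] parallel_iff_scale[of f g] outer_scale by blast
qed

text \<open>A nonzero row serves as \<open>f\<close>, and the factors expressing the rows through it
  are the coordinates of \<open>u\<close>.\<close>

lemma mat3_parallel_rows_outer:
  assumes A: "A \<in> carrier_mat 3 3" and "\<And>i j. i < 3 \<Longrightarrow> j < 3 \<Longrightarrow> cross (row3 A i) (row3 A j) = 0"
  obtains u f where "A = outer u f"
proof (cases "\<forall>i<3. row3 A i = 0")
  case True
  then have "A = 0\<^sub>m 3 3"
    using A by (subst mat3_eq_iff) (auto simp: row3_def zero_prod_def less_3_iff)
  then have "A = outer 0 0"
    using outer_eq_0_iff by metis
  then show ?thesis by (rule that)
next
  case False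
  then obtain i where i: "i < 3" "row3 A i \<noteq> 0" by blast
  have "\<forall>j\<in>{..<3}. \<exists>k. row3 A j = scale k (row3 A i)"
    using assms(2)[OF i(1)] parallel_iff_scale[OF i(2)] by blast
  then obtain k where k: "\<And>j. j < 3 \<Longrightarrow> row3 A j = scale (k j) (row3 A i)"
    by (metis lessThan_iff)
  have "A = outer (k 0, k 1, k 2) (row3 A i)"
    using A k[of 0] k[of 1] k[of 2]
    by (subst mat3_eq_iff) (auto simp: less_3_iff row3_def)
  then show ?thesis by (rule that)
qed

text \<open>Row rank at least 2 gives column rank at least 2, since both say that some 2 x 2 minor
  is nonzero.\<close>

lemma nonparallel_rows_imp_cols:
  assumes "cross (row3 A i) (row3 A j) \<noteq> 0" "i < 3" "j < 3"
  shows "\<exists>k<3. \<exists>l<3. cross (col3 A k) (col3 A l) \<noteq> 0"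
proof (rule ccontr)
  have entries: "entry (row3 A i) k = A $$ (i, k)" "entry (col3 A k) i = A $$ (i, k)" if "i < 3" "k < 3" for i k
    using that by (auto simp: row3_def col3_def less_3_iff)
  assume "\<not> (\<exists>k<3. \<exists>l<3. cross (col3 A k) (col3 A l) \<noteq> 0)"
  then have "A $$ (i, k) * A $$ (j, l) = A $$ (j, k) * A $$ (i, l)" if "k < 3" "l < 3" for k l
    using that assms(2,3) by (auto simp: parallel_iff_entries entries)
  then have "cross (row3 A i) (row3 A j) = 0"
    using assms(2,3) by (auto simp: parallel_iff_entries entries mult.commute)
  with assms(1) show False ..
qed

section \<open>Nilpotency and rank of 3 x 3 matrices\<close>

lemma smult_smult_mat:
  fixes A :: "'a::semigroup_mult mat"
  shows "k \<cdot>\<^sub>m (l \<cdot>\<^sub>m A) = (k * l) \<cdot>\<^sub>m A"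
  by (auto intro!: eq_matI simp: mult.assoc)

lemma smult_eq_0_iff_3:
  fixes A :: "'a::field mat"
  assumes "A \<in> carrier_mat 3 3"
  shows "k \<cdot>\<^sub>m A = 0\<^sub>m 3 3 \<longleftrightarrow> k = 0 \<or> A = 0\<^sub>m 3 3"
  using assms by (subst (1 2) mat3_eq_iff) auto

lemma mult_smult_smult_3:
  fixes A B :: "'a::field mat"
  assumes "A \<in> carrier_mat 3 3" "B \<in> carrier_mat 3 3"
  shows "(k \<cdot>\<^sub>m A) * (l \<cdot>\<^sub>m B) = (k * l) \<cdot>\<^sub>m (A * B)"
  using assms
  by (simp add: mult_smult_distrib[of _ 3 3] mult_smult_assoc_mat[of _ 3 3] smult_smult_mat mult.commute)

lemma cayley_hamilton_3:
  fixes A :: "'a::field mat"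
  assumes A: "A \<in> carrier_mat 3 3"
  obtains t e d where "A * A * A = t \<cdot>\<^sub>m (A * A) + (e \<cdot>\<^sub>m A + d \<cdot>\<^sub>m 1\<^sub>m 3)"
proof -
  define a where "a i j = A $$ (i, j)" for i j
  \<comment> \<open>The coefficients of the characteristic polynomial: \<open>t\<close> is the
    trace, \<open>e\<close> is minus the sum of the principal 2 x 2 minors, and \<open>d\<close> is
    the determinant as a scalar triple product of the rows.\<close>
  define t where "t = a 0 0 + a 1 1 + a 2 2"
  define e where "e = a 0 1 * a 1 0 - a 0 0 * a 1 1 + (a 0 2 * a 2 0 - a 0 0 * a 2 2)
    + (a 1 2 * a 2 1 - a 1 1 * a 2 2)"
  define d where "d = dot (row3 A 0) (cross (row3 A 1) (row3 A 2))"
  have AA: "A * A \<in> carrier_mat 3 3" "A * A * A \<in> carrier_mat 3 3" using A by auto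
  have sq: "(A * A) $$ (i, j) = a i 0 * a 0 j + a i 1 * a 1 j + a i 2 * a 2 j" if "i < 3" "j < 3" for i j
    using that A by (simp add: mult_index_3 row3_def col3_def a_def del: index_mult_mat)
  have cube: "(A * A * A) $$ (i, j) = (A * A) $$ (i, 0) * a 0 j + (A * A) $$ (i, 1) * a 1 j + (A * A) $$ (i, 2) * a 2 j"
    if "i < 3" "j < 3" for i j
    using that A AA
    by (simp add: mult_index_3[of "A * A"] row3_def[of "A * A"] col3_def a_def
        del: index_mult_mat assoc_mult_mat)
  have "(A * A * A) $$ (i, j) = t * (A * A) $$ (i, j) + (e * a i j + d * (1\<^sub>m 3) $$ (i, j))"
    if "i < 3" "j < 3" for i j
    using that
    by (auto simp: less_3_iff cube sq t_def e_def d_def row3_def a_def[symmetric] algebra_simps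
        simp del: index_mult_mat assoc_mult_mat)
  then have "A * A * A = t \<cdot>\<^sub>m (A * A) + (e \<cdot>\<^sub>m A + d \<cdot>\<^sub>m 1\<^sub>m 3)"
    using A AA by (subst mat3_eq_iff) (auto simp: a_def simp del: index_mult_mat(1) assoc_mult_mat)
  then show ?thesis by (rule that)
qed

text \<open>If the cube were nonzero, multiplying the Cayley-Hamilton relation by powers of
  \<open>x\<close> would force its coefficients to vanish one by one, leaving a zero cube after
  all.\<close>

lemma nilpotent3_cube:
  fixes x :: "'a::field mat"
  assumes "x \<in> nilpotent3"
  shows "x * x * x = 0\<^sub>m 3 3"
proof (rule ccontr)
  assume ne: "x * x * x \<noteq> 0\<^sub>m 3 3"
  have x: "x \<in> carrier_mat 3 3" and "\<exists>n. x ^\<^sub>m n = 0\<^sub>m 3 3"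
    using assms by (auto simp: nilpotent3_def)
  define P where "P n = x ^\<^sub>m n" for n
  have P: "P n \<in> carrier_mat 3 3" for n
    using x by (simp add: P_def)
  have P_Suc: "P (Suc n) = P n * x" for n
    by (simp add: P_def)
  have P_3: "P (n + 3) = P n * (x * x * x)" for n
    using x P[of n] by (simp add: P_Suc eval_nat_numeral assoc_mult_mat[of _ 3 3 _ 3 _ 3])
  have P_2: "P (n + 2) = P n * (x * x)" for n
    using x P[of n] by (simp add: P_Suc eval_nat_numeral assoc_mult_mat[of _ 3 3 _ 3 _ 3])
  have zero_add: "P (n + j) = 0\<^sub>m 3 3" if "P n = 0\<^sub>m 3 3" for n j
    using that x by (induction j) (auto simp: P_Suc)
  obtain n where n: "P n = 0\<^sub>m 3 3" "\<And>j. j < n \<Longrightarrow> P j \<noteq> 0\<^sub>m 3 3"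
    using exists_least_iff[of "\<lambda>n. P n = 0\<^sub>m 3 3"] \<open>\<exists>n. x ^\<^sub>m n = 0\<^sub>m 3 3\<close>
    unfolding P_def by auto
  have "P 3 \<noteq> 0\<^sub>m 3 3"
    using ne P_3[of 0] x by (simp add: P_def)
  then have "\<not> n \<le> 3"
    using zero_add[OF n(1), of "3 - n"] by auto
  \<comment> \<open>The least vanishing exponent is at least 4, so \<open>P (k + 3)\<close> is the
    last nonzero power.\<close>
  then obtain k where k: "n = k + 4"
    using le_Suc_ex[of 4 n] by (auto simp: add.commute)
  obtain t e d where "x * x * x = t \<cdot>\<^sub>m (x * x) + (e \<cdot>\<^sub>m x + d \<cdot>\<^sub>m 1\<^sub>m 3)"
    using cayley_hamilton_3[OF x] .
  then have "P (m + 3) = t \<cdot>\<^sub>m P (m + 2) + (e \<cdot>\<^sub>m P (m + 1) + d \<cdot>\<^sub>m P m)" for m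
    using x P[of m] unfolding P_3 P_2
    by (simp add: P_Suc mult_add_distrib_mat[of _ 3 3 _ 3] mult_smult_distrib[of _ 3 3 _ 3])
  then have rec: "P (m + 3) $$ (i, j) = t * P (m + 2) $$ (i, j) + (e * P (m + 1) $$ (i, j) + d * P m $$ (i, j))"
    if "i < 3" "j < 3" for m i j
    using that P[of m] P[of "m + 1"] P[of "m + 2"] by simp
  have zero: "P j = 0\<^sub>m 3 3" if "k + 4 \<le> j" for j
    using zero_add[OF n(1), of "j - n"] that k by simp
  have "P (k + 3) \<noteq> 0\<^sub>m 3 3" using n(2) k by simp
  then obtain i j where ij: "i < 3" "j < 3" "P (k + 3) $$ (i, j) \<noteq> 0"
    using P by (subst (asm) mat3_eq_iff) auto
  have nz: "P (k + 2 + 1) $$ (i, j) \<noteq> 0" "P (k + 1 + 2) $$ (i, j) \<noteq> 0"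
    using ij(3) by (simp_all add: eval_nat_numeral)
  \<comment> \<open>At \<open>m = k + 3\<close>, \<open>k + 2\<close> and \<open>k + 1\<close> the
    recurrence retains only the multiple of \<open>P (k + 3)\<close> by \<open>d\<close>,
    \<open>e\<close> and \<open>t\<close> in turn.\<close>
  have "d = 0"
    using rec[OF ij(1,2), of "k + 3"] zero[of "k + 3 + 3"] zero[of "k + 3 + 2"] zero[of "k + 3 + 1"] ij
    by simp
  moreover from this have "e = 0"
    using rec[OF ij(1,2), of "k + 2"] zero[of "k + 2 + 3"] zero[of "k + 2 + 2"] ij nz(1) by simp
  moreover from calculation have "t = 0"
    using rec[OF ij(1,2), of "k + 1"] zero[of "k + 1 + 3"] ij nz(2) by simp
  ultimately have "P 3 = 0\<^sub>m 3 3"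
    using P rec[of _ _ 0] by (subst mat3_eq_iff) auto
  with \<open>P 3 \<noteq> 0\<^sub>m 3 3\<close> show False ..
qed

text \<open>Every row is orthogonal to every column. Two nonparallel rows would make all columns
  parallel, contradicting \<open>nonparallel_rows_imp_cols\<close>.\<close>

lemma square_zero_imp_outer:
  assumes A: "A \<in> carrier_mat 3 3" and sq: "A * A = 0\<^sub>m 3 3" and "A \<noteq> 0\<^sub>m 3 3"
  obtains u f where "A = outer u f" "u \<noteq> 0" "f \<noteq> 0" "dot f u = 0"
proof -
  have orth: "dot (row3 A i) (col3 A k) = 0" if "i < 3" "k < 3" for i k
    using sq that unfolding mult_eq_0_iff_3[OF A A] by blast
  have "cross (row3 A i) (row3 A j) = 0" if ij: "i < 3" "j < 3" for i j
  proof (rule ccontr)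
    assume ne: "cross (row3 A i) (row3 A j) \<noteq> 0"
    then obtain k l where "k < 3" "l < 3" "cross (col3 A k) (col3 A l) \<noteq> 0"
      using nonparallel_rows_imp_cols ij by blast
    then show False
      using orthogonal_dichotomy[of "row3 A i" "col3 A k" "col3 A l" "row3 A j"] ne ij orth by blast
  qed
  then obtain u f where A_eq: "A = outer u f"
    using mat3_parallel_rows_outer[OF A] by blast
  then have "u \<noteq> 0" "f \<noteq> 0"
    using \<open>A \<noteq> 0\<^sub>m 3 3\<close> outer_eq_0_iff by blast+
  moreover from this have "dot f u = 0"
    using sq unfolding A_eq outer_mult_eq_0_iff by simp
  ultimately show ?thesis
    using that[OF A_eq] by simp
qed

lemma mult_outer_eq_0_iff:
  assumes "A \<in> carrier_mat 3 3" "u \<noteq> 0" "f \<noteq> 0"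
  shows "A * outer u f = 0\<^sub>m 3 3 \<longleftrightarrow> (\<forall>i<3. dot (row3 A i) u = 0)"
    and "outer u f * A = 0\<^sub>m 3 3 \<longleftrightarrow> (\<forall>j<3. dot f (col3 A j) = 0)"
proof -
  have "dot (scale c v) w = c * dot v w" "dot v (scale c w) = c * dot v w" for c and v w :: "'a triple"
    by (cases v; cases w; simp add: algebra_simps)+
  then show "A * outer u f = 0\<^sub>m 3 3 \<longleftrightarrow> (\<forall>i<3. dot (row3 A i) u = 0)"
    and "outer u f * A = 0\<^sub>m 3 3 \<longleftrightarrow> (\<forall>j<3. dot f (col3 A j) = 0)"
    using assms by (auto simp: mult_eq_0_iff_3 row3_outer col3_outer triple_eq_0_iff)
qed

text \<open>Vectors orthogonal to two independent rows of \<open>x\<close>, or to two independent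
  columns, are determined up to a scalar.\<close>

lemma annihilator_unique:
  assumes x: "x \<in> carrier_mat 3 3" and ij: "i < 3" "j < 3" "cross (row3 x i) (row3 x j) \<noteq> 0"
    and uf: "u \<noteq> 0" "f \<noteq> 0" "x * outer u f = 0\<^sub>m 3 3" "outer u f * x = 0\<^sub>m 3 3"
    and vg: "v \<noteq> 0" "g \<noteq> 0" "x * outer v g = 0\<^sub>m 3 3" "outer v g * x = 0\<^sub>m 3 3"
  shows "cross u v = 0" "cross f g = 0"
proof -
  obtain k l where kl: "k < 3" "l < 3" "cross (col3 x k) (col3 x l) \<noteq> 0"
    using nonparallel_rows_imp_cols[OF ij(3,1,2)] by blast
  have "dot (row3 x i) u = 0" "dot (row3 x i) v = 0" "dot (row3 x j) u = 0" "dot (row3 x j) v = 0"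
    using uf vg ij x by (simp_all add: mult_outer_eq_0_iff)
  then show "cross u v = 0"
    using orthogonal_dichotomy ij(3) by blast
  have "dot f (col3 x k) = 0" "dot f (col3 x l) = 0" "dot g (col3 x k) = 0" "dot g (col3 x l) = 0"
    using uf vg kl x by (simp_all add: mult_outer_eq_0_iff)
  then show "cross f g = 0"
    using orthogonal_dichotomy kl(3) by blast
qed

lemma outer_square: "outer u f * outer u f = dot f u \<cdot>\<^sub>m outer u f"
proof -
  have "dot (scale a f) (scale b u) = a * b * dot f u" for a b
    by (cases f; cases u) (simp add: algebra_simps)
  then show ?thesis
    by (subst mat3_eq_iff)
      (auto simp: mult_index_3 row3_outer col3_outer mult_carrier_mat[of _ 3 3] simp del: index_mult_mat(1))
qed

text \<open>With all rows parallel, \<open>x\<close> would be an outer product whose cube is the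
  square of \<open>dot f u\<close> times \<open>x\<close>; then \<open>dot f u = 0\<close> or
  \<open>x\<close> is zero, and \<open>x * x\<close> vanishes.\<close>

lemma rank_2_nonparallel_rows:
  assumes x: "x \<in> carrier_mat 3 3" and cube: "x * x * x = 0\<^sub>m 3 3" and sq: "x * x \<noteq> 0\<^sub>m 3 3"
  obtains i j where "i < 3" "j < 3" "cross (row3 x i) (row3 x j) \<noteq> 0"
proof (rule ccontr)
  assume "\<not> thesis"
  with that have "\<And>i j. i < 3 \<Longrightarrow> j < 3 \<Longrightarrow> cross (row3 x i) (row3 x j) = 0"
    by blast
  then obtain u f where x_eq: "x = outer u f"
    using mat3_parallel_rows_outer[OF x] by blast
  have "x * x * x = (dot f u * dot f u) \<cdot>\<^sub>m x"
    unfolding x_eq outer_square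
    by (simp add: mult_smult_assoc_mat[of _ 3 3 _ 3] outer_square smult_smult_mat)
  then have "dot f u = 0 \<or> x = 0\<^sub>m 3 3"
    using cube smult_eq_0_iff_3[OF x] by (metis mult_eq_0_iff)
  then have "x * x = 0\<^sub>m 3 3"
    using x by (auto simp: x_eq outer_square smult_eq_0_iff_3)
  with sq show False ..
qed

section \<open>Lines spanned by matrices and their adjacency\<close>

lemma line_eq_iff:
  assumes "a \<in> carrier_mat 3 3" "b \<in> carrier_mat 3 3" "b \<noteq> 0\<^sub>m 3 3"
  shows "line a = line b \<longleftrightarrow> (\<exists>k. b = k \<cdot>\<^sub>m a)"
proof
  have "b = 1 \<cdot>\<^sub>m b" using assms by auto
  moreover assume "line a = line b"
  ultimately show "\<exists>k. b = k \<cdot>\<^sub>m a" unfolding line_def by blast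
next
  assume "\<exists>k. b = k \<cdot>\<^sub>m a"
  then obtain k where k: "b = k \<cdot>\<^sub>m a" by blast
  then have "k \<noteq> 0" using assms by (auto simp: smult_eq_0_iff_3)
  have "c \<cdot>\<^sub>m b = (c * k) \<cdot>\<^sub>m a" "c \<cdot>\<^sub>m a = (c / k) \<cdot>\<^sub>m b" for c
    using \<open>k \<noteq> 0\<close> by (simp_all add: k smult_smult_mat)
  then show "line a = line b" unfolding line_def by blast
qed

text \<open>Rescaling representatives only rescales the two products, so adjacency can be tested on
  any of them.\<close>

lemma parcs_orth_graph_iff:
  assumes "S \<subseteq> carrier_mat 3 3" "a \<in> S - {0\<^sub>m 3 3}" "b \<in> S - {0\<^sub>m 3 3}"
  shows "(line a, line b) \<in> parcs (orth_graph S) \<longleftrightarrow>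
    line a \<noteq> line b \<and> a * b = 0\<^sub>m 3 3 \<and> b * a = 0\<^sub>m 3 3"
proof
  assume "(line a, line b) \<in> parcs (orth_graph S)"
  then obtain a' b' where *: "line a = line a'" "line b = line b'" "line a' \<noteq> line b'"
    "a' \<in> S - {0\<^sub>m 3 3}" "b' \<in> S - {0\<^sub>m 3 3}" "a' * b' = 0\<^sub>m 3 3" "b' * a' = 0\<^sub>m 3 3"
    by (auto simp: orth_graph_def)
  have c: "a \<in> carrier_mat 3 3" "b \<in> carrier_mat 3 3" "a' \<in> carrier_mat 3 3" "b' \<in> carrier_mat 3 3"
    using assms * by auto
  obtain k l where "a = k \<cdot>\<^sub>m a'" "b = l \<cdot>\<^sub>m b'"
    using * assms(2,3) line_eq_iff[OF c(3,1)] line_eq_iff[OF c(4,2)] by auto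
  with * c show "line a \<noteq> line b \<and> a * b = 0\<^sub>m 3 3 \<and> b * a = 0\<^sub>m 3 3"
    by (auto simp: mult_smult_smult_3 smult_eq_0_iff_3)
qed (use assms in \<open>auto simp: orth_graph_def\<close>)

section \<open>The orthogonality graph of nilpotent matrices\<close>

definition is_flag :: "'a::field triple \<Rightarrow> 'a triple \<Rightarrow> bool" where
  "is_flag u f \<longleftrightarrow> u \<noteq> 0 \<and> f \<noteq> 0 \<and> dot f u = 0"

definition flag_lines :: "'a::field mat set set" where
  "flag_lines = {line (outer u f) | u f. is_flag u f}"

text \<open>The point as the span of \<open>u\<close>, zero vector included. Collecting over all
  representing flags avoids a choice; \<open>flag_point_line\<close> shows that they agree.\<close>

definition flag_point :: "'a::field mat set \<Rightarrow> 'a triple set" where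
  "flag_point X = {v. \<exists>u f. is_flag u f \<and> X = line (outer u f) \<and> cross u v = 0}"

text \<open>The line of the projective plane, encoded as the span of the linear form
  \<open>f\<close>.\<close>

definition flag_axis :: "'a::field mat set \<Rightarrow> 'a triple set" where
  "flag_axis X = {g. \<exists>u f. is_flag u f \<and> X = line (outer u f) \<and> cross f g = 0}"

lemma line_outer_eq_iff:
  assumes "is_flag u f" "is_flag v g"
  shows "line (outer u f) = line (outer v g) \<longleftrightarrow> cross u v = 0 \<and> cross f g = 0"
  using assms by (auto simp: is_flag_def line_eq_iff outer_eq_0_iff outer_eq_smult_iff)

lemma parallel_class_eq_iff:
  assumes "u \<noteq> 0" "v \<noteq> 0"
  shows "{w. cross u w = 0} = {w. cross v w = 0} \<longleftrightarrow> cross u v = 0"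
proof
  assume "{w. cross u w = 0} = {w. cross v w = 0}"
  then have "v \<in> {w. cross u w = 0}" by simp
  then show "cross u v = 0" by simp
next
  assume uv: "cross u v = 0"
  have vu: "cross v u = 0" using uv cross_eq_0_commute by blast
  show "{w. cross u w = 0} = {w. cross v w = 0}"
    using parallel_trans[OF assms(1) uv] parallel_trans[OF assms(2) vu] by blast
qed

lemma flag_point_line: "is_flag u f \<Longrightarrow> flag_point (line (outer u f)) = {v. cross u v = 0}"
  unfolding flag_point_def using line_outer_eq_iff parallel_class_eq_iff is_flag_def by blast

lemma flag_axis_line: "is_flag u f \<Longrightarrow> flag_axis (line (outer u f)) = {g. cross f g = 0}"
  unfolding flag_axis_def using line_outer_eq_iff parallel_class_eq_iff is_flag_def by blast

lemma flag_point_eq_iff: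
  assumes "is_flag u f" "is_flag v g"
  shows "flag_point (line (outer u f)) = flag_point (line (outer v g)) \<longleftrightarrow> cross u v = 0"
  using assms by (simp add: flag_point_line parallel_class_eq_iff is_flag_def)

lemma flag_axis_eq_iff:
  assumes "is_flag u f" "is_flag v g"
  shows "flag_axis (line (outer u f)) = flag_axis (line (outer v g)) \<longleftrightarrow> cross f g = 0"
  using assms by (simp add: flag_axis_line parallel_class_eq_iff is_flag_def)

lemma nilpotent3_carrier: "nilpotent3 \<subseteq> carrier_mat 3 3"
  by (auto simp: nilpotent3_def)

lemma pow_mat_2: "x \<in> carrier_mat n n \<Longrightarrow> x ^\<^sub>m 2 = x * x"
  by (simp add: numeral_2_eq_2)

lemma square_zero_nilpotent3: "x \<in> carrier_mat 3 3 \<Longrightarrow> x * x = 0\<^sub>m 3 3 \<Longrightarrow> x \<in> nilpotent3"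
  unfolding nilpotent3_def using pow_mat_2[of x 3] by auto

lemma outer_nilpotent3: "is_flag u f \<Longrightarrow> outer u f \<in> nilpotent3 - {0\<^sub>m 3 3}"
  using square_zero_nilpotent3[of "outer u f"]
  by (simp add: is_flag_def outer_mult_eq_0_iff outer_eq_0_iff)

lemma line_in_flag_lines_iff:
  assumes "x \<in> nilpotent3 - {0\<^sub>m 3 3}"
  shows "line x \<in> flag_lines \<longleftrightarrow> x * x = 0\<^sub>m 3 3"
proof
  have x: "x \<in> carrier_mat 3 3" using assms nilpotent3_carrier by blast
  {
    assume "line x \<in> flag_lines"
    then obtain u f where uf: "is_flag u f" "line (outer u f) = line x"
      by (auto simp: flag_lines_def)
    then obtain k where "x = k \<cdot>\<^sub>m outer u f"
      using line_eq_iff[OF outer_carrier x] assms by auto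
    moreover have "outer u f * outer u f = 0\<^sub>m 3 3"
      using uf(1) by (simp add: outer_mult_eq_0_iff is_flag_def)
    ultimately show "x * x = 0\<^sub>m 3 3"
      by (simp add: mult_smult_smult_3)
  next
    assume "x * x = 0\<^sub>m 3 3"
    then show "line x \<in> flag_lines"
      using square_zero_imp_outer[OF x] assms unfolding flag_lines_def is_flag_def by blast
  }
qed

text \<open>The neighbour is the line of \<open>x * x\<close>, which squares to zero and annihilates
  \<open>x\<close> because the cube of \<open>x\<close> is zero. Any annihilating \<open>b\<close>
  is shown to be an outer product, and \<open>annihilator_unique\<close> identifies it.\<close>

lemma pendant_nilpotent:
  assumes x: "x \<in> nilpotent3 - {0\<^sub>m 3 3}" and sq: "x * x \<noteq> 0\<^sub>m 3 3"
  shows "\<exists>C\<in>flag_lines. \<forall>B. (line x, B) \<in> parcs (orth_graph nilpotent3) \<longleftrightarrow> B = C"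
proof -
  have c: "x \<in> carrier_mat 3 3" using x nilpotent3_carrier by blast
  have cube: "x * x * x = 0\<^sub>m 3 3" using nilpotent3_cube x by blast
  have cube': "x * (x * x) = 0\<^sub>m 3 3" using cube c by (simp add: assoc_mult_mat[of _ 3 3 _ 3 _ 3])
  have "x * x * (x * x) = x * x * x * x" using c by (simp add: assoc_mult_mat[of _ 3 3 _ 3 _ 3])
  then have "x * x * (x * x) = 0\<^sub>m 3 3" using c by (simp add: cube)
  then obtain u f where uf: "x * x = outer u f" "is_flag u f"
    using square_zero_imp_outer[OF mult_carrier_mat[OF c c] _ sq] unfolding is_flag_def by blast
  obtain i j where ij: "i < 3" "j < 3" "cross (row3 x i) (row3 x j) \<noteq> 0"
    using rank_2_nonparallel_rows[OF c cube sq] .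
  have nl: "line x \<noteq> line (outer v g)" if "is_flag v g" for v g
    using line_in_flag_lines_iff[OF x] sq that unfolding flag_lines_def by blast
  have "(line x, B) \<in> parcs (orth_graph nilpotent3) \<longleftrightarrow> B = line (outer u f)" for B
  proof
    assume "B = line (outer u f)"
    moreover have "x * outer u f = 0\<^sub>m 3 3" "outer u f * x = 0\<^sub>m 3 3"
      using cube cube' uf by simp_all
    ultimately show "(line x, B) \<in> parcs (orth_graph nilpotent3)"
      using parcs_orth_graph_iff[OF nilpotent3_carrier x outer_nilpotent3[OF uf(2)]] nl[OF uf(2)] by simp
  next
    assume arc: "(line x, B) \<in> parcs (orth_graph nilpotent3)"
    then obtain b where b: "b \<in> nilpotent3 - {0\<^sub>m 3 3}" "B = line b"
      by (auto simp: orth_graph_def)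
    with arc have ann: "x * b = 0\<^sub>m 3 3" "b * x = 0\<^sub>m 3 3"
      using parcs_orth_graph_iff[OF nilpotent3_carrier x b(1)] by simp_all
    have bc: "b \<in> carrier_mat 3 3" using b nilpotent3_carrier by blast
    have orth: "dot (row3 x i) (col3 b l) = 0" "dot (row3 x j) (col3 b l) = 0" if "l < 3" for l
      using ann(1) ij that unfolding mult_eq_0_iff_3[OF c bc] by blast+
    \<comment> \<open>The columns of \<open>b\<close> are orthogonal to two nonparallel rows of
      \<open>x\<close>, hence parallel to each other; so the rows of \<open>b\<close> are parallel
      too.\<close>
    have "cross (row3 b k) (row3 b l) = 0" if kl: "k < 3" "l < 3" for k l
    proof (rule ccontr)
      assume "cross (row3 b k) (row3 b l) \<noteq> 0"
      then obtain m n where "m < 3" "n < 3" "cross (col3 b m) (col3 b n) \<noteq> 0"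
        using nonparallel_rows_imp_cols kl by blast
      then show False
        using orthogonal_dichotomy[of "row3 x i" "col3 b m" "col3 b n" "row3 x j"] orth ij(3) by blast
    qed
    then obtain v g where vg: "b = outer v g"
      using mat3_parallel_rows_outer[OF bc] by blast
    then have ne: "v \<noteq> 0" "g \<noteq> 0" using b outer_eq_0_iff by blast+
    have ne': "u \<noteq> 0" "f \<noteq> 0" using uf by (simp_all add: is_flag_def)
    have "cross u v = 0" "cross f g = 0"
      using annihilator_unique[OF c ij, of u f v g] ne ne' ann cube cube' uf(1) vg by simp_all
    then show "B = line (outer u f)"
      using line_eq_iff[OF outer_carrier bc, of u f] outer_eq_smult_iff[OF ne' ne] b vg by auto
  qed
  moreover have "line (outer u f) \<in> flag_lines" unfolding flag_lines_def using uf(2) by blast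
  ultimately show ?thesis by blast
qed

text \<open>Existence of joins and meets comes from cross products, their uniqueness from
  \<open>orthogonal_dichotomy\<close>; the pendant vertices are the lines of nilpotents with nonzero
  square.\<close>

lemma pendant_flag_graph_nilpotent3:
  "pendant_flag_graph (orth_graph nilpotent3 :: 'a::field mat set pair_pre_digraph)
    flag_lines flag_point flag_axis"
proof -
  let ?G = "orth_graph nilpotent3 :: 'a mat set pair_pre_digraph"
  interpret pair_bidirected_digraph ?G
    by (rule pair_bidirected_orth_graph)
  have flagE: thesis if "A \<in> flag_lines" "\<And>u f. is_flag u f \<Longrightarrow> A = line (outer u f) \<Longrightarrow> thesis"
    for A :: "'a mat set" and thesis
    using that by (auto simp: flag_lines_def)
  have mem: "line (outer u f) \<in> flag_lines" if "is_flag u f" for u f :: "'a triple"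
    unfolding flag_lines_def using that by blast
  note eq_iffs = flag_point_eq_iff flag_axis_eq_iff line_outer_eq_iff
  show ?thesis
  proof unfold_locales
    show "flag_lines \<subseteq> pverts ?G"
    proof
      fix A :: "'a mat set" assume "A \<in> flag_lines"
      then obtain u f where "is_flag u f" "A = line (outer u f)" by (rule flagE)
      then show "A \<in> pverts ?G"
        using outer_nilpotent3[of u f] by (auto simp: orth_graph_def)
    qed
  next
    fix A B :: "'a mat set" assume "A \<in> flag_lines" "B \<in> flag_lines"
    then obtain u f v g where
      A: "is_flag u f" "A = line (outer u f)" and B: "is_flag v g" "B = line (outer v g)"
      by (elim flagE)
    \<comment> \<open>Mutual annihilation says that each point lies on the line of the other flag.
      Then both points lie on both lines, so the points or the lines coincide.\<close>
    have "dot f v = 0 \<and> dot g u = 0 \<longleftrightarrow> cross u v = 0 \<or> cross f g = 0"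
    proof
      assume "dot f v = 0 \<and> dot g u = 0"
      then show "cross u v = 0 \<or> cross f g = 0"
        using A B orthogonal_dichotomy[of f u v g] by (simp add: is_flag_def)
    next
      assume "cross u v = 0 \<or> cross f g = 0"
      then show "dot f v = 0 \<and> dot g u = 0"
        using A B dot_parallel[of u v f] dot_parallel[of v u g] dot_parallel[of f g u] dot_parallel[of g f v]
        by (auto simp: is_flag_def dot_commute cross_eq_0_commute)
    qed
    then show "(A, B) \<in> parcs ?G \<longleftrightarrow>
        A \<noteq> B \<and> (flag_point A = flag_point B \<or> flag_axis A = flag_axis B)"
      using A B parcs_orth_graph_iff[OF nilpotent3_carrier outer_nilpotent3[OF A(1)] outer_nilpotent3[OF B(1)]]
      by (auto simp: eq_iffs outer_mult_eq_0_iff is_flag_def)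
    show "A = B" if "flag_point A = flag_point B" "flag_axis A = flag_axis B"
      using that A B by (simp add: eq_iffs)
    show "\<exists>C\<in>flag_lines. \<exists>D\<in>flag_lines.
        flag_point C = flag_point A \<and> flag_point D = flag_point B \<and> flag_axis C = flag_axis D"
      if "flag_point A \<noteq> flag_point B"
    proof -
      \<comment> \<open>\<open>cross u v\<close> is the form vanishing at both points, that is,
        their join.\<close>
      have "is_flag u (cross u v)" "is_flag v (cross u v)"
        using that A B by (simp_all add: eq_iffs is_flag_def)
      then show ?thesis
        using A B by (intro bexI[of _ "line (outer u (cross u v))"] bexI[of _ "line (outer v (cross u v))"])
          (simp_all add: eq_iffs mem)
    qed
    show "\<exists>C\<in>flag_lines. \<exists>D\<in>flag_lines.
        flag_axis C = flag_axis A \<and> flag_axis D = flag_axis B \<and> flag_point C = flag_point D"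
      if "flag_axis A \<noteq> flag_axis B"
    proof -
      \<comment> \<open>Dually, \<open>cross f g\<close> is the point where the two lines
        meet.\<close>
      have "is_flag (cross f g) f" "is_flag (cross f g) g"
        using that A B by (simp_all add: eq_iffs is_flag_def)
      then show ?thesis
        using A B by (intro bexI[of _ "line (outer (cross f g) f)"] bexI[of _ "line (outer (cross f g) g)"])
          (simp_all add: eq_iffs mem)
    qed
  next
    fix A A' B B' :: "'a mat set"
    assume mems: "A \<in> flag_lines" "A' \<in> flag_lines" "B \<in> flag_lines" "B' \<in> flag_lines"
      and eqs: "flag_point A = flag_point A'" "flag_point B = flag_point B'"
        "flag_axis A = flag_axis B" "flag_axis A' = flag_axis B'"
    obtain u f where A: "is_flag u f" "A = line (outer u f)" using mems(1) by (rule flagE)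
    obtain u' f' where A': "is_flag u' f'" "A' = line (outer u' f')" using mems(2) by (rule flagE)
    obtain v g where B: "is_flag v g" "B = line (outer v g)" using mems(3) by (rule flagE)
    obtain v' g' where B': "is_flag v' g'" "B' = line (outer v' g')" using mems(4) by (rule flagE)
    have par: "cross u' u = 0" "cross v' v = 0" "cross g f = 0" "cross g' f' = 0"
      using eqs A A' B B' by (simp_all add: eq_iffs cross_eq_0_commute)
    \<comment> \<open>Moving along parallel representatives puts both points \<open>u\<close> and
      \<open>v\<close> on both lines \<open>f\<close> and \<open>f'\<close>.\<close>
    have "dot f u = 0" using A by (simp add: is_flag_def)
    moreover have "dot f v = 0"
      using dot_parallel[of g f v] par B by (simp add: is_flag_def dot_commute)
    moreover have "dot f' u = 0"
      using dot_parallel[of u' u f'] par A' by (simp add: is_flag_def)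
    moreover have "dot f' v = 0"
      using dot_parallel[of g' f' v'] dot_parallel[of v' v f'] par B' by (simp add: is_flag_def dot_commute)
    ultimately have "cross u v = 0 \<or> cross f f' = 0"
      by (rule orthogonal_dichotomy)
    then show "flag_point A = flag_point B \<or> flag_axis A = flag_axis A'"
      using A A' B by (simp add: eq_iffs)
  next
    fix A :: "'a mat set" assume "A \<in> pverts ?G" "A \<notin> flag_lines"
    then obtain x where "x \<in> nilpotent3 - {0\<^sub>m 3 3}" "A = line x" "x * x \<noteq> 0\<^sub>m 3 3"
      using line_in_flag_lines_iff by (auto simp: orth_graph_def)
    then show "\<exists>C\<in>flag_lines. \<forall>B. (A, B) \<in> parcs ?G \<longleftrightarrow> B = C"
      using pendant_nilpotent by blast
  qed
qed

theorem corollary5p7: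
  fixes x y :: "'a::field mat" and k :: nat
  assumes "CHAR('a) \<noteq> 3"
    and "\<exists>w::'a. primitive_cube_root w"
    and "x \<in> nilpotent3" "x \<noteq> 0\<^sub>m 3 3"
    and "y \<in> nilpotent3" "y \<noteq> 0\<^sub>m 3 3"
    and "graph_dist (orth_graph nilpotent3) (line x) (line y) = ereal (real k)"
    and "k \<le> 5"
  shows "((\<exists>!p. p \<in> paths_of_length (orth_graph nilpotent3) k (line x) (line y)) \<or>
          card (paths_of_length (orth_graph nilpotent3) k (line x) (line y)) = 2) \<and>
         (card (paths_of_length (orth_graph nilpotent3) k (line x) (line y)) = 2 \<longleftrightarrow>
           (k = 3 \<and> x ^\<^sub>m 2 = 0\<^sub>m 3 3 \<and> y ^\<^sub>m 2 = 0\<^sub>m 3 3) \<or>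
           (k = 4 \<and> (x ^\<^sub>m 2 = 0\<^sub>m 3 3 \<or> y ^\<^sub>m 2 = 0\<^sub>m 3 3)) \<or>
           k = 5)"
proof -
  interpret pendant_flag_graph "orth_graph nilpotent3 :: 'a mat set pair_pre_digraph"
    flag_lines flag_point flag_axis
    by (rule pendant_flag_graph_nilpotent3)
  have x: "x \<in> nilpotent3 - {0\<^sub>m 3 3}" and y: "y \<in> nilpotent3 - {0\<^sub>m 3 3}"
    using assms by simp_all
  have sq: "x ^\<^sub>m 2 = 0\<^sub>m 3 3 \<longleftrightarrow> line x \<in> flag_lines" "y ^\<^sub>m 2 = 0\<^sub>m 3 3 \<longleftrightarrow> line y \<in> flag_lines"
    using x y nilpotent3_carrier by (auto simp: line_in_flag_lines_iff pow_mat_2[of _ 3])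
  have geo: "geodesic_length k (line x) (line y)"
    using assms(7) by (rule graph_dist_eq_imp_geodesic_length)
  have verts: "line x \<in> pverts (orth_graph nilpotent3)" "line y \<in> pverts (orth_graph nilpotent3)"
    using x y by (auto simp: orth_graph_def)
  have ex1: "(\<exists>!p. p \<in> W) \<longleftrightarrow> card W = 1" for W :: "('a mat set \<times> 'a mat set) awalk set"
    unfolding One_nat_def card_1_singleton_iff by blast
  show ?thesis
    unfolding sq paths_of_length_eq_walks[OF geo] ex1
    using card_geodesics[OF verts geo] by argo
qed

end
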